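(* Let $p$ be a prime and $d>2$ an integer. Then there exist constants $C>0$ and $\gamma$ with $1\le\gamma<p$, depending only on $p$ and $d$, such that for every $n\ge1$, every $d$-colored sum-ordered set in $\mathbb F_p^n$ has size $N\le C\gamma^n$ (i.e. $N=O(\gamma^n)$).
   Context: For a poset $P=([d],<_P)$ on $[d]$ and $t\ge0$, the order polytope is $\mathcal O_t(P)=\{(z_1,\dots,z_d)\in\mathbb R^d: 0\le z_i\le t \text{ for all } i,\ z_i\le z_j \text{ whenever } i<_P j\}$. A $d$-colored sum-ordered set in $\mathbb F_p^n$ of size $N$ is an ordered collection $(x^{(\ell)}_i)_{\ell\in[d],\,i\in[N]}$ of vectors $x^{(\ell)}_i\in\mathbb F_p^n$ such that $\sum_{\ell=1}^d x^{(\ell)}_i=0$ for every $i\in[N]$, and such that there is a poset $P$ on $[d]$ whose Hasse diagram is connected (as an undirected graph) with the property: for all $i_1,\dots,i_d\in[N]$, $\sum_{\ell=1}^d x^{(\ell)}_{i_\ell}=0$ implies $(i_1,\dots,i_d)\in\mathcal O_N(P)$. *)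

theory Defs
  imports Complex_Main "HOL-Library.FuncSet" "HOL-Number_Theory.Residues"
begin

text \<open>
  Posets on a set \<open>A\<close> are given by their reflexive relation \<open>P\<close>, i.e. by
  \<open>partial_order_on A P\<close> with \<open>(i, j) \<in> P\<close> meaning \<open>i \<le> j\<close>; the strict order is \<open>P - Id\<close>.
\<close>

definition hasse_diagram :: "('a \<times> 'a) set \<Rightarrow> ('a \<times> 'a) set" where
  "hasse_diagram P =
    {(a, b) \<in> P - Id. \<not> (\<exists>c. (a, c) \<in> P - Id \<and> (c, b) \<in> P - Id)}"

definition hasse_connected :: "'a set \<Rightarrow> ('a \<times> 'a) set \<Rightarrow> bool" where
  "hasse_connected A P \<longleftrightarrow>
    (\<forall>a\<in>A. \<forall>b\<in>A. (a, b) \<in> (hasse_diagram P \<union> (hasse_diagram P)\<inverse>)\<^sup>*)"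

text \<open>Points of \<open>\<real>\<^sup>d\<close> are extensional functions on \<open>{1..d}\<close>.\<close>

definition order_polytope :: "nat \<Rightarrow> (nat \<times> nat) set \<Rightarrow> real \<Rightarrow> (nat \<Rightarrow> real) set" where
  "order_polytope d P t =
    {z \<in> {1..d} \<rightarrow>\<^sub>E UNIV.
      (\<forall>i\<in>{1..d}. 0 \<le> z i \<and> z i \<le> t) \<and> (\<forall>(i, j)\<in>P - Id. z i \<le> z j)}"

text \<open>
  For prime \<open>p\<close>, the field with \<open>p\<close> elements is \<open>residue_ring (int p)\<close>, with carrier
  \<open>{0..int p - 1}\<close>; its \<open>n\<close>-dimensional coordinate space consists of the extensional functions
  on \<open>{1..n}\<close> with values in that carrier.
\<close>

definition Fp_space :: "nat \<Rightarrow> nat \<Rightarrow> (nat \<Rightarrow> int) set" where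
  "Fp_space p n = {1..n} \<rightarrow>\<^sub>E carrier (residue_ring (int p))"

definition Fp_zero :: "nat \<Rightarrow> nat \<Rightarrow> nat \<Rightarrow> int" where
  "Fp_zero p n = (\<lambda>k\<in>{1..n}. \<zero>\<^bsub>residue_ring (int p)\<^esub>)"

definition Fp_sum :: "nat \<Rightarrow> nat \<Rightarrow> ('a \<Rightarrow> nat \<Rightarrow> int) \<Rightarrow> 'a set \<Rightarrow> nat \<Rightarrow> int" where
  "Fp_sum p n v A = (\<lambda>k\<in>{1..n}. \<Oplus>\<^bsub>residue_ring (int p)\<^esub>l\<in>A. v l k)"

text \<open>The vector of colour \<open>l\<close> and index \<open>i\<close> is \<open>x l i\<close>; only \<open>l \<in> {1..d}\<close> and
  \<open>i \<in> {1..N}\<close> are relevant.\<close>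

definition sum_ordered_set ::
  "nat \<Rightarrow> nat \<Rightarrow> nat \<Rightarrow> nat \<Rightarrow> (nat \<Rightarrow> nat \<Rightarrow> nat \<Rightarrow> int) \<Rightarrow> bool" where
  "sum_ordered_set p n d N x \<longleftrightarrow>
    (\<forall>l\<in>{1..d}. \<forall>i\<in>{1..N}. x l i \<in> Fp_space p n) \<and>
    (\<forall>i\<in>{1..N}. Fp_sum p n (\<lambda>l. x l i) {1..d} = Fp_zero p n) \<and>
    (\<exists>P. partial_order_on {1..d} P \<and> hasse_connected {1..d} P \<and>
      (\<forall>i \<in> {1..d} \<rightarrow>\<^sub>E {1..N}.
        Fp_sum p n (\<lambda>l. x l (i l)) {1..d} = Fp_zero p n \<longrightarrow>
        (\<lambda>l\<in>{1..d}. real (i l)) \<in> order_polytope d P (real N)))"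

end

theory Submission
  imports Defs
begin

text \<open>
  This is the slice rank method with a triangular instead of a diagonal tensor. Let \<open>T i\<close> be the
  indicator that the vectors \<open>x l (i l)\<close> sum to zero. By Fermat it is a polynomial of degree
  \<open>n (p - 1)\<close>, so each of its monomials has degree at most \<open>n (p - 1) / d\<close> in the coordinates of
  some colour; for \<open>d > 2\<close> there are only exponentially fewer than \<open>p ^ n\<close> such monomials.

  Order the index set upwards for the colours that are minimal in the poset, and downwards for the
  others. Call \<open>s\<close> a leading index of a colour if some weight vector that annihilates all monomials
  of low degree in that colour has \<open>s\<close> as the first point of its support. If \<open>N\<close> exceeds \<open>d\<close> times
  the number of monomials, some \<open>s\<close> is leading for all colours. Summing \<open>T\<close> against the product of
  the corresponding weights gives zero, by the expansion into monomials. But \<open>T i \<noteq> 0\<close> forces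
  \<open>i\<close> to be monotone on the poset, and a monotone \<open>i\<close> whose minimal entries are at least \<open>s\<close> and
  whose other entries are at most \<open>s\<close> is constant, so that the sum is a single nonzero term.
\<close>

section \<open>Leading indices\<close>

text \<open>The annihilator of \<open>card M\<close> functionals has codimension at most
  \<open>card M\<close>, and a subspace has as many leading indices as its dimension. The proof
  counts instead: two coefficient vectors on the non-leading indices with equal moments modulo
  \<open>p\<close> would differ by an annihilating vector that leads at a non-leading index, so
  these vectors are at most as many as the moment vectors.\<close>

lemma card_not_leading_le:
  fixes \<kappa> :: "'a \<Rightarrow> 'b::linorder" and F :: "'a \<Rightarrow> 'm \<Rightarrow> int" and p :: nat
  assumes fin: "finite A" "finite M" and inj: "inj_on \<kappa> A" and p: "p > 1"
  shows "card {s\<in>A. \<nexists>v. \<not> int p dvd v s \<and> (\<forall>j\<in>A. \<kappa> j < \<kappa> s \<longrightarrow> v j = 0) \<and>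
                   (\<forall>m\<in>M. int p dvd (\<Sum>j\<in>A. v j * F j m))} \<le> card M"
proof -
  let ?R = "{0..<int p}"
  define B where "B = {s\<in>A. \<nexists>v. \<not> int p dvd v s \<and> (\<forall>j\<in>A. \<kappa> j < \<kappa> s \<longrightarrow> v j = 0) \<and>
                   (\<forall>m\<in>M. int p dvd (\<Sum>j\<in>A. v j * F j m))}"
  define \<phi> where "\<phi> c = (\<lambda>m\<in>M. (\<Sum>b\<in>B. c b * F b m) mod int p)" for c
  have finB: "finite B" and BA: "B \<subseteq> A" using fin by (auto simp: B_def)
  have "inj_on \<phi> (B \<rightarrow>\<^sub>E ?R)"
  proof (rule inj_onI, rule ccontr)
    fix c e
    assume c: "c \<in> B \<rightarrow>\<^sub>E ?R" and e: "e \<in> B \<rightarrow>\<^sub>E ?R" and eq: "\<phi> c = \<phi> e" and "c \<noteq> e"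
    define D where "D = {b\<in>B. c b \<noteq> e b}"
    have "D \<noteq> {}"
      using \<open>c \<noteq> e\<close> PiE_ext[OF c e] unfolding D_def by blast
    moreover have finD: "finite D" using finB by (simp add: D_def)
    ultimately have "Min (\<kappa> ` D) \<in> \<kappa> ` D" by simp
    \<comment> \<open>The first place of disagreement. Entries of \<open>c\<close> and
      \<open>e\<close> are reduced residues, so unequal entries stay distinct modulo
      \<open>p\<close> and \<open>c - e\<close> leads at \<open>s\<close>.\<close>
    then obtain s where s: "s \<in> D" "\<kappa> s = Min (\<kappa> ` D)" by force
    have s_min: "\<kappa> s \<le> \<kappa> b" if "b \<in> D" for b using that s finD by simp
    have sB: "s \<in> B" using s by (simp add: D_def)
    define v where "v j = (if j \<in> B then c j - e j else 0)" for j
    have "\<not> int p dvd v s"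
    proof
      assume "int p dvd v s"
      then have "c s mod int p = e s mod int p" using sB by (simp add: v_def mod_eq_dvd_iff)
      moreover have "c s \<in> ?R" "e s \<in> ?R" using c e sB by (auto dest!: PiE_mem)
      ultimately show False using s by (simp add: D_def)
    qed
    moreover have "v j = 0" if "j \<in> A" "\<kappa> j < \<kappa> s" for j
      using s_min[of j] that by (force simp: v_def D_def)
    moreover have "int p dvd (\<Sum>j\<in>A. v j * F j m)" if "m \<in> M" for m
    proof -
      have "(\<Sum>j\<in>A. v j * F j m) = (\<Sum>b\<in>B. (c b - e b) * F b m)"
        using fin BA by (intro sum.mono_neutral_cong_right) (auto simp: v_def)
      moreover have "\<phi> c m = \<phi> e m" using eq by simp
      ultimately show ?thesis
        using that by (simp add: \<phi>_def mod_eq_dvd_iff left_diff_distrib sum_subtractf)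
    qed
    ultimately show False using sB unfolding B_def by blast
  qed
  moreover have "\<phi> ` (B \<rightarrow>\<^sub>E ?R) \<subseteq> M \<rightarrow>\<^sub>E ?R" using p by (auto simp: \<phi>_def)
  ultimately have "card (B \<rightarrow>\<^sub>E ?R) \<le> card (M \<rightarrow>\<^sub>E ?R)"
    using fin by (intro card_inj_on_le) (auto intro: finite_PiE)
  then have "p ^ card B \<le> p ^ card M"
    using fin finB by (simp add: card_PiE)
  then show ?thesis using p by (simp add: B_def)
qed

section \<open>Expansion into monomials\<close>

text \<open>Expanding the product picks one colour from each of the \<open>q\<close> factors
  belonging to each \<open>k\<close>; the word \<open>w\<close> records the picks. Exponents are
  indexed by \<open>K\<close>, being 0 off \<open>X\<close>, so that all \<open>X\<close> share one
  set of exponent vectors.\<close>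

lemma prod_power_sum_words:
  fixes y :: "'l \<Rightarrow> 'k \<Rightarrow> int"
  assumes fin: "finite L" "finite K" and "X \<subseteq> K"
  shows "(\<Prod>k\<in>X. (\<Sum>l\<in>L. y l k) ^ q) =
    (\<Sum>w\<in>X \<times> {..<q} \<rightarrow>\<^sub>E L. \<Prod>l\<in>L. \<Prod>k\<in>K. y l k ^ card {t. k \<in> X \<and> t < q \<and> w (k, t) = l})"
proof -
  have finX: "finite X" using assms finite_subset by auto
  have "(\<Prod>k\<in>X. (\<Sum>l\<in>L. y l k) ^ q) = (\<Prod>k\<in>X. \<Prod>t\<in>{..<q}. \<Sum>l\<in>L. y l k)"
    by simp
  also have "\<dots> = (\<Prod>z\<in>X \<times> {..<q}. \<Sum>l\<in>L. y l (fst z))"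
    unfolding prod.cartesian_product case_prod_unfold ..
  also have "\<dots> = (\<Sum>w\<in>X \<times> {..<q} \<rightarrow>\<^sub>E L. \<Prod>z\<in>X \<times> {..<q}. y (w z) (fst z))"
    using fin finX by (intro prod_sum_PiE) auto
  also have "\<dots> = (\<Sum>w\<in>X \<times> {..<q} \<rightarrow>\<^sub>E L. \<Prod>l\<in>L. \<Prod>k\<in>K. y l k ^ card {t. k \<in> X \<and> t < q \<and> w (k, t) = l})"
  proof (rule sum.cong[OF refl])
    fix w assume w: "w \<in> X \<times> {..<q} \<rightarrow>\<^sub>E L"
    have fiber: "(\<Prod>t\<in>{..<q}. y (w (k, t)) k) =
        (\<Prod>l\<in>L. y l k ^ card {t. k \<in> X \<and> t < q \<and> w (k, t) = l})" if "k \<in> X" for k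
    proof -
      have "(\<Prod>t\<in>{..<q}. y (w (k, t)) k) = (\<Prod>l\<in>L. \<Prod>t\<in>{t\<in>{..<q}. w (k, t) = l}. y (w (k, t)) k)"
        using fin w that by (intro prod.group[symmetric]) auto
      also have "\<dots> = (\<Prod>l\<in>L. \<Prod>t\<in>{t\<in>{..<q}. w (k, t) = l}. y l k)"
        by (intro prod.cong) auto
      finally show ?thesis using that by simp
    qed
    have "(\<Prod>z\<in>X \<times> {..<q}. y (w z) (fst z)) = (\<Prod>k\<in>X. \<Prod>t\<in>{..<q}. y (w (k, t)) k)"
      by (simp add: prod.cartesian_product case_prod_unfold)
    also have "\<dots> = (\<Prod>k\<in>X. \<Prod>l\<in>L. y l k ^ card {t. k \<in> X \<and> t < q \<and> w (k, t) = l})"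
      using fiber by (rule prod.cong[OF refl])
    also have "\<dots> = (\<Prod>k\<in>K. \<Prod>l\<in>L. y l k ^ card {t. k \<in> X \<and> t < q \<and> w (k, t) = l})"
      using assms by (intro prod.mono_neutral_left) auto
    finally show "(\<Prod>z\<in>X \<times> {..<q}. y (w z) (fst z)) =
        (\<Prod>l\<in>L. \<Prod>k\<in>K. y l k ^ card {t. k \<in> X \<and> t < q \<and> w (k, t) = l})"
      by (subst prod.swap) simp
  qed
  finally show ?thesis .
qed

text \<open>Each position \<open>(k, t)\<close> is counted once, for the colour that it
  carries.\<close>

lemma sum_word_degrees:
  assumes fin: "finite L" "finite K" and "X \<subseteq> K" and w: "w \<in> X \<times> {..<q} \<rightarrow>\<^sub>E L"
  shows "(\<Sum>l\<in>L. \<Sum>k\<in>K. card {t. k \<in> X \<and> t < q \<and> w (k, t) = l}) = card X * q"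
proof -
  have "(\<Sum>l\<in>L. card {t. k \<in> X \<and> t < q \<and> w (k, t) = l}) = (if k \<in> X then q else 0)" for k
  proof (cases "k \<in> X")
    case True
    have "(\<Sum>l\<in>L. \<Sum>t\<in>{t\<in>{..<q}. w (k, t) = l}. 1) = (\<Sum>t\<in>{..<q}. (1::nat))"
      using fin w True by (intro sum.group) auto
    then show ?thesis using True by simp
  qed simp
  then have "(\<Sum>k\<in>K. \<Sum>l\<in>L. card {t. k \<in> X \<and> t < q \<and> w (k, t) = l}) =
      (\<Sum>k\<in>K. if k \<in> X then q else 0)"
    by simp
  also have "\<dots> = (\<Sum>k\<in>X. q)"
    using assms by (intro sum.mono_neutral_cong_right) auto
  finally show ?thesis by (subst sum.swap) simp
qed

text \<open>Each term of the expansion is a product of one monomial per colour, so its weighted sum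
  over \<open>i\<close> factors over the colours. Some colour has at most the average degree, and
  \<open>kills\<close> makes its factor divisible by \<open>c\<close>.\<close>

lemma dvd_weighted_sum:
  fixes x :: "'l \<Rightarrow> 'j \<Rightarrow> 'k \<Rightarrow> int"
  assumes fin: "finite L" "finite J" "finite K" and "L \<noteq> {}"
    and kills: "\<And>l \<alpha>. l \<in> L \<Longrightarrow> \<alpha> \<in> K \<rightarrow>\<^sub>E {..q} \<Longrightarrow> card L * sum \<alpha> K \<le> card K * q \<Longrightarrow>
      c dvd (\<Sum>j\<in>J. v l j * (\<Prod>k\<in>K. x l j k ^ \<alpha> k))"
  shows "c dvd (\<Sum>i\<in>L \<rightarrow>\<^sub>E J. (\<Prod>l\<in>L. v l (i l)) * (\<Prod>k\<in>K. 1 - (\<Sum>l\<in>L. x l (i l) k) ^ q))"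
proof -
  define W where "W X = X \<times> {..<q} \<rightarrow>\<^sub>E L" for X :: "'k set"
  define a where "a X w l k = card {t. k \<in> X \<and> t < q \<and> w (k, t) = l}"
    for X :: "'k set" and w :: "'k \<times> nat \<Rightarrow> 'l" and l k
  have expand: "(\<Prod>k\<in>K. 1 - (\<Sum>l\<in>L. x l (i l) k) ^ q) =
      (\<Sum>X\<in>Pow K. \<Sum>w\<in>W X. (- 1) ^ card X * (\<Prod>l\<in>L. \<Prod>k\<in>K. x l (i l) k ^ a X w l k))" for i
  proof -
    have "(\<Prod>k\<in>K. 1 - (\<Sum>l\<in>L. x l (i l) k) ^ q) = (\<Prod>k\<in>K. - ((\<Sum>l\<in>L. x l (i l) k) ^ q) + 1)"
      by simp
    also have "\<dots> = (\<Sum>X\<in>Pow K. (- 1) ^ card X * (\<Prod>k\<in>X. (\<Sum>l\<in>L. x l (i l) k) ^ q))"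
      by (subst prod_add[OF fin(3)]) (simp add: prod_uminus)
    also have "\<dots> = (\<Sum>X\<in>Pow K. \<Sum>w\<in>W X. (- 1) ^ card X * (\<Prod>l\<in>L. \<Prod>k\<in>K. x l (i l) k ^ a X w l k))"
    proof (rule sum.cong[OF refl])
      fix X assume "X \<in> Pow K"
      then show "(- 1) ^ card X * (\<Prod>k\<in>X. (\<Sum>l\<in>L. x l (i l) k) ^ q) =
        (\<Sum>w\<in>W X. (- 1) ^ card X * (\<Prod>l\<in>L. \<Prod>k\<in>K. x l (i l) k ^ a X w l k))"
        using prod_power_sum_words[OF fin(1,3), of X "\<lambda>l k. x l (i l) k" q]
        by (simp add: W_def a_def sum_distrib_left)
    qed
    finally show ?thesis .
  qed
  have "(\<Sum>i\<in>L \<rightarrow>\<^sub>E J. (\<Prod>l\<in>L. v l (i l)) * (\<Prod>k\<in>K. 1 - (\<Sum>l\<in>L. x l (i l) k) ^ q)) =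
      (\<Sum>i\<in>L \<rightarrow>\<^sub>E J. \<Sum>X\<in>Pow K. \<Sum>w\<in>W X.
        (- 1) ^ card X * (\<Prod>l\<in>L. v l (i l) * (\<Prod>k\<in>K. x l (i l) k ^ a X w l k)))"
    by (simp add: expand sum_distrib_left prod.distrib mult_ac)
  also have "\<dots> = (\<Sum>X\<in>Pow K. \<Sum>w\<in>W X. \<Sum>i\<in>L \<rightarrow>\<^sub>E J.
        (- 1) ^ card X * (\<Prod>l\<in>L. v l (i l) * (\<Prod>k\<in>K. x l (i l) k ^ a X w l k)))"
    by (subst sum.swap, rule sum.cong[OF refl], rule sum.swap)
  also have "\<dots> = (\<Sum>X\<in>Pow K. \<Sum>w\<in>W X.
        (- 1) ^ card X * (\<Prod>l\<in>L. \<Sum>j\<in>J. v l j * (\<Prod>k\<in>K. x l j k ^ a X w l k)))"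
    using fin by (simp add: prod_sum_PiE sum_distrib_left)
  also have "c dvd \<dots>"
  proof (intro dvd_sum dvd_mult)
    fix X w assume X: "X \<in> Pow K" and w: "w \<in> W X"
    have total: "(\<Sum>l\<in>L. \<Sum>k\<in>K. a X w l k) = card X * q"
      using sum_word_degrees[OF fin(1,3)] X w by (simp add: W_def a_def)
    \<comment> \<open>Otherwise the total degree would exceed \<open>card K * q\<close>, while it is
      \<open>card X * q\<close>.\<close>
    have "\<exists>l\<in>L. card L * (\<Sum>k\<in>K. a X w l k) \<le> card K * q"
    proof (rule ccontr)
      assume "\<not> ?thesis"
      then have "(\<Sum>l\<in>L. card K * q) < (\<Sum>l\<in>L. card L * (\<Sum>k\<in>K. a X w l k))"
        using fin \<open>L \<noteq> {}\<close> by (intro sum_strict_mono) auto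
      also have "\<dots> = card L * (card X * q)"
        by (simp add: total flip: sum_distrib_left)
      also have "\<dots> \<le> card L * (card K * q)"
        using X fin by (intro mult_le_mono) (auto intro: card_mono)
      finally show False by simp
    qed
    then obtain l where l: "l \<in> L" "card L * (\<Sum>k\<in>K. a X w l k) \<le> card K * q" by blast
    have "a X w l k \<le> q" for k
      using card_mono[of "{..<q}" "{t. k \<in> X \<and> t < q \<and> w (k, t) = l}"] by (auto simp: a_def)
    then have "c dvd (\<Sum>j\<in>J. v l j * (\<Prod>k\<in>K. x l j k ^ restrict (a X w l) K k))"
      using l by (intro kills) auto
    then have "c dvd (\<Sum>j\<in>J. v l j * (\<Prod>k\<in>K. x l j k ^ a X w l k))"
      by simp
    also have "\<dots> dvd (\<Prod>l\<in>L. \<Sum>j\<in>J. v l j * (\<Prod>k\<in>K. x l j k ^ a X w l k))"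
      using l fin by (intro dvd_prodI) auto
    finally show "c dvd \<dots>" .
  qed
  finally show ?thesis .
qed

lemma prod_one_minus_power_cong:
  fixes y :: "'k \<Rightarrow> int"
  assumes p: "prime p" and K: "finite K"
  shows "[(\<Prod>k\<in>K. 1 - y k ^ (p - 1)) = of_bool (\<forall>k\<in>K. int p dvd y k)] (mod int p)"
proof (cases "\<forall>k\<in>K. int p dvd y k")
  case True
  \<comment> \<open>A positive exponent, so that a multiple of \<open>p\<close> has a power
    divisible by \<open>p\<close>, not the value 1.\<close>
  have "p - 1 > 0" using p prime_gt_1_nat by auto
  then have "[1 - y k ^ (p - 1) = 1] (mod int p)" if "k \<in> K" for k
    using True that by (auto simp: cong_iff_dvd_diff intro: dvd_trans dvd_power)
  then have "[(\<Prod>k\<in>K. 1 - y k ^ (p - 1)) = (\<Prod>k\<in>K. 1)] (mod int p)"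
    by (rule cong_prod)
  then show ?thesis using True by simp
next
  case False
  then obtain k where k: "k \<in> K" "\<not> int p dvd y k" by blast
  let ?r = "nat (y k mod int p)"
  have p0: "int p > 0" using p prime_gt_0_nat by simp
  have r: "int ?r = y k mod int p" using p0 by simp
  have "\<not> p dvd ?r"
    using k r by (metis dvd_mod_iff dvd_refl int_dvd_int_iff)
  then have "[?r ^ (p - 1) = 1] (mod p)" using p by (rule fermat_theorem[rotated])
  then have "[int ?r ^ (p - 1) = 1] (mod int p)"
    by (metis cong_int_iff of_nat_1 of_nat_power)
  then have "[y k ^ (p - 1) = 1] (mod int p)"
    unfolding r by (simp add: cong_def power_mod)
  then have "int p dvd 1 - y k ^ (p - 1)"
    by (simp add: cong_iff_dvd_diff dvd_diff_commute)
  also have "\<dots> dvd (\<Prod>k\<in>K. 1 - y k ^ (p - 1))"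
    using k K by (intro dvd_prodI) auto
  finally show ?thesis unfolding of_bool_def if_not_P[OF False] cong_0_iff .
qed

section \<open>Counting monomials of low degree\<close>

text \<open>Exponential moment bound: give \<alpha> the weight t^(3 deg \<alpha>). Each vector
  counted weighs at least \<open>t ^ (card K * q)\<close>, and the total weight of all vectors
  factors over the coordinates. Weakening \<open>d\<close> to 3 makes the bound independent of
  \<open>d\<close>.\<close>

lemma card_low_degree_le:
  fixes t :: real
  assumes t: "0 < t" "t < 1" and "d \<ge> 3" and K: "finite K"
  shows "real (card {\<alpha> \<in> K \<rightarrow>\<^sub>E {..q}. d * sum \<alpha> K \<le> card K * q}) \<le>
    ((\<Sum>a\<le>q. t ^ (3 * a)) / t ^ q) ^ card K"
    (is "real (card ?M) \<le> _")
proof -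
  have fin: "finite (K \<rightarrow>\<^sub>E {..q})" using K by (simp add: finite_PiE)
  have "real (card ?M) * t ^ (card K * q) = (\<Sum>\<alpha>\<in>?M. t ^ (card K * q))"
    by simp
  also have "\<dots> \<le> (\<Sum>\<alpha>\<in>?M. t ^ (3 * sum \<alpha> K))"
  proof (rule sum_mono)
    fix \<alpha> assume "\<alpha> \<in> ?M"
    then have "3 * sum \<alpha> K \<le> card K * q"
      using mult_le_mono1[OF \<open>d \<ge> 3\<close>, of "sum \<alpha> K"] \<open>\<alpha> \<in> ?M\<close> by (simp only: mem_Collect_eq) linarith
    then show "t ^ (card K * q) \<le> t ^ (3 * sum \<alpha> K)"
      using t by (intro power_decreasing) auto
  qed
  also have "\<dots> \<le> (\<Sum>\<alpha>\<in>K \<rightarrow>\<^sub>E {..q}. t ^ (3 * sum \<alpha> K))"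
    using t fin by (intro sum_mono2) auto
  also have "\<dots> = (\<Sum>\<alpha>\<in>K \<rightarrow>\<^sub>E {..q}. \<Prod>k\<in>K. t ^ (3 * \<alpha> k))"
    by (simp add: power_sum sum_distrib_left)
  also have "\<dots> = (\<Sum>a\<le>q. t ^ (3 * a)) ^ card K"
    using K prod_sum_PiE[of K "\<lambda>_. {..q}" "\<lambda>_ a. t ^ (3 * a)"] by simp
  finally show ?thesis
    using t by (simp add: power_divide power_mult[symmetric] pos_le_divide_eq mult.commute)
qed

text \<open>At t = 1 the ratio equals q + 1. There the derivative of \<open>f\<close> is 3q(q+1)/2 -
  q(q+1) > 0, so \<open>f\<close> is negative just to the left of 1. With 2 in place of 3 this
  derivative would vanish.\<close>

lemma exists_power_sum_ratio_less:
  assumes "q \<ge> 1"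
  shows "\<exists>t::real. 0 < t \<and> t < 1 \<and> (\<Sum>a\<le>q. t ^ (3 * a)) / t ^ q < real (q + 1)"
proof -
  define f where "f t = (\<Sum>a\<le>q. t ^ (3 * a)) - real (q + 1) * t ^ q" for t :: real
  have gauss: "(\<Sum>a\<le>q. real a) = real q * (real q + 1) / 2"
    by (induction q) (auto simp: field_simps)
  have "(f has_real_derivative (\<Sum>a\<le>q. real (3 * a)) - real (q + 1) * real q) (at 1)"
    unfolding f_def by (auto intro!: derivative_eq_intros)
  moreover have "(\<Sum>a\<le>q. real (3 * a)) = 3 * (real q * (real q + 1) / 2)"
    unfolding gauss[symmetric] by (simp add: sum_distrib_left)
  then have "0 < (\<Sum>a\<le>q. real (3 * a)) - real (q + 1) * real q"
    using assms by (simp only:) (simp add: field_simps add_pos_pos)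
  ultimately obtain e where e: "e > 0" "\<And>h. h > 0 \<Longrightarrow> h < e \<Longrightarrow> f (1 - h) < f 1"
    using DERIV_pos_inc_left by blast
  define t where "t = 1 - min (e / 2) (1 / 2)"
  have t: "0 < t" "t < 1" using e by (auto simp: t_def)
  have "f t < f 1"
    unfolding t_def by (rule e(2)) (use e(1) in auto)
  then have "(\<Sum>a\<le>q. t ^ (3 * a)) < real (q + 1) * t ^ q" by (simp add: f_def)
  then show ?thesis using t by (intro exI[of _ t]) (simp add: pos_divide_less_eq)
qed

section \<open>Sum-ordered sets\<close>

text \<open>Moves the zero-sum condition to the integers, where the polynomial expansion takes
  place.\<close>

lemma Fp_sum_eq_Fp_zero_iff:
  assumes "p > 1" and "finite A" and v: "\<And>l. l \<in> A \<Longrightarrow> v l \<in> Fp_space p n"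
  shows "Fp_sum p n v A = Fp_zero p n \<longleftrightarrow> (\<forall>k\<in>{1..n}. int p dvd (\<Sum>l\<in>A. v l k))"
proof -
  interpret residues "int p" "residue_ring (int p)"
    using assms by unfold_locales auto
  have "(\<Oplus>\<^bsub>residue_ring (int p)\<^esub>l\<in>A. v l k) = (\<Sum>l\<in>A. v l k) mod int p" if "k \<in> {1..n}" for k
  proof -
    have "(\<Oplus>\<^bsub>residue_ring (int p)\<^esub>l\<in>A. v l k) = (\<Oplus>\<^bsub>residue_ring (int p)\<^esub>l\<in>A. v l k mod int p)"
    proof (rule finsum_cong'[OF refl])
      fix l assume "l \<in> A"
      then have "v l k \<in> {0..int p - 1}"
        using PiE_mem[OF v[unfolded Fp_space_def res_carrier_eq] that] by blast
      then show "v l k = v l k mod int p" by simp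
    qed (use assms in \<open>auto simp: res_carrier_eq\<close>)
    then show ?thesis using sum_cong[OF \<open>finite A\<close>] by simp
  qed
  moreover have "\<zero>\<^bsub>residue_ring (int p)\<^esub> = 0" by (rule res_zero_eq)
  ultimately show ?thesis
    unfolding Fp_sum_def Fp_zero_def by (auto simp: fun_eq_iff restrict_def dvd_eq_mod_eq_0)
qed

section \<open>Monotone maps on posets with connected Hasse diagram\<close>

lemma hasse_connected_comparable:
  assumes "hasse_connected A P" "a \<in> A" "b \<in> A" "a \<noteq> b"
  shows "\<exists>c. (a, c) \<in> P - Id \<or> (c, a) \<in> P - Id"
proof -
  have "(a, b) \<in> (hasse_diagram P \<union> (hasse_diagram P)\<inverse>)\<^sup>*"
    using assms by (auto simp: hasse_connected_def)
  then obtain c where "(a, c) \<in> hasse_diagram P \<union> (hasse_diagram P)\<inverse>"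
    using \<open>a \<noteq> b\<close> by (auto elim: converse_rtranclE)
  then show ?thesis by (auto simp: hasse_diagram_def)
qed

lemma partial_order_on_minimal_below:
  assumes P: "partial_order_on A P" and "finite A" and b: "b \<in> A"
  obtains a where "(a, b) \<in> P" "a \<in> A" "\<And>c. (c, a) \<notin> P - Id"
proof -
  let ?D = "{a\<in>A. (a, b) \<in> P}"
  note refl = partial_order_onD(1)[OF P] and trans = partial_order_onD(2)[OF P]
    and antisym = partial_order_onD(3)[OF P]
  have sub: "P \<subseteq> A \<times> A" using P by (auto simp: partial_order_on_def preorder_on_def)
  have "\<exists>m\<in>?D. \<forall>c\<in>?D. c \<noteq> m \<longrightarrow> \<not> (c, m) \<in> P - Id"
  proof (rule Finite_Set.bex_min_element)
    show "finite ?D" using \<open>finite A\<close> by simp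
    show "asymp_on ?D (\<lambda>c m. (c, m) \<in> P - Id)"
      using antisym by (auto simp: asymp_on_def dest: antisymD)
    show "transp_on ?D (\<lambda>c m. (c, m) \<in> P - Id)"
      using antisym trans by (auto simp: transp_on_def dest: antisymD transD)
    show "?D \<noteq> {}" using b refl by (auto dest: refl_onD)
  qed
  then obtain m where m: "m \<in> ?D" and min: "\<And>c. c \<in> ?D \<Longrightarrow> c \<noteq> m \<Longrightarrow> (c, m) \<notin> P - Id"
    by blast
  have "(c, m) \<notin> P - Id" for c
    using min[of c] m sub trans by (auto dest: transD)
  with m that show thesis by auto
qed

text \<open>A non-minimal \<open>l\<close> has value at most \<open>s\<close>, and at least that of
  a minimal element below it, which is at least \<open>s\<close>. A minimal \<open>l\<close> has
  value at least \<open>s\<close>, and by connectedness lies below a non-minimal element, whose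
  value is at most \<open>s\<close>.\<close>

lemma monotone_between_constant:
  fixes i :: "'a \<Rightarrow> 'b::order"
  assumes P: "partial_order_on A P" and "finite A" and conn: "hasse_connected A P"
    and two: "\<And>a. a \<in> A \<Longrightarrow> \<exists>b\<in>A. a \<noteq> b"
    and mono: "\<And>a b. (a, b) \<in> P - Id \<Longrightarrow> i a \<le> i b"
    and low: "\<And>a. a \<in> A \<Longrightarrow> (\<forall>c. (c, a) \<notin> P - Id) \<Longrightarrow> s \<le> i a"
    and high: "\<And>a c. a \<in> A \<Longrightarrow> (c, a) \<in> P - Id \<Longrightarrow> i a \<le> s"
    and l: "l \<in> A"
  shows "i l = s"
proof (cases "\<exists>c. (c, l) \<in> P - Id")
  case True
  then have "i l \<le> s" using high l by blast
  moreover obtain a where a: "(a, l) \<in> P" "a \<in> A" "\<And>c. (c, a) \<notin> P - Id"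
    using partial_order_on_minimal_below[OF P \<open>finite A\<close> l] by blast
  then have "s \<le> i l" using low[of a] mono[of a l] by (cases "a = l") auto
  ultimately show ?thesis by simp
next
  case False
  then obtain b where b: "(l, b) \<in> P - Id"
    using hasse_connected_comparable[OF conn l] two[OF l] by blast
  then have "b \<in> A" using P by (auto simp: partial_order_on_def preorder_on_def)
  then have "i l \<le> s" using mono[OF b] high[OF _ b] by simp
  moreover have "s \<le> i l" using low[OF l] False by blast
  ultimately show ?thesis by simp
qed

section \<open>Bounding the size by the number of monomials of low degree\<close>

lemma sum_ordered_set_card_le:
  assumes p: "prime p" and d: "d > 2" and x: "sum_ordered_set p n d N x"
  shows "N \<le> d * card {\<alpha> \<in> {1..n} \<rightarrow>\<^sub>E {..p - 1}. d * sum \<alpha> {1..n} \<le> n * (p - 1)}"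
    (is "N \<le> d * card ?M")
proof (rule ccontr)
  assume large: "\<not> N \<le> d * card ?M"
  have p1: "p > 1" using p prime_gt_1_nat by blast
  have finM: "finite ?M"
    by (rule finite_subset[of _ "{1..n} \<rightarrow>\<^sub>E {..p - 1}"]) (auto intro: finite_PiE)
  obtain P where P: "partial_order_on {1..d} P" "hasse_connected {1..d} P"
    and poly: "\<And>i. i \<in> {1..d} \<rightarrow>\<^sub>E {1..N} \<Longrightarrow> Fp_sum p n (\<lambda>l. x l (i l)) {1..d} = Fp_zero p n \<Longrightarrow>
        (\<lambda>l\<in>{1..d}. real (i l)) \<in> order_polytope d P (real N)"
    and mem: "\<And>l i. l \<in> {1..d} \<Longrightarrow> i \<in> {1..N} \<Longrightarrow> x l i \<in> Fp_space p n"
    and diag: "\<And>i. i \<in> {1..N} \<Longrightarrow> Fp_sum p n (\<lambda>l. x l i) {1..d} = Fp_zero p n"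
    using x unfolding sum_ordered_set_def by blast
  have sub: "P \<subseteq> {1..d} \<times> {1..d}"
    using P(1) by (auto simp: partial_order_on_def preorder_on_def)
  define Z where "Z i \<longleftrightarrow> (\<forall>k\<in>{1..n}. int p dvd (\<Sum>l\<in>{1..d}. x l (i l) k))" for i
  have Z_mono: "i a \<le> i b" if "i \<in> {1..d} \<rightarrow>\<^sub>E {1..N}" "Z i" "(a, b) \<in> P - Id" for i a b
  proof -
    have "Fp_sum p n (\<lambda>l. x l (i l)) {1..d} = Fp_zero p n"
      using that mem p1 by (subst Fp_sum_eq_Fp_zero_iff) (auto simp: Z_def dest: PiE_mem)
    from poly[OF that(1) this] that(3)
    have "(\<lambda>l\<in>{1..d}. real (i l)) a \<le> (\<lambda>l\<in>{1..d}. real (i l)) b"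
      unfolding order_polytope_def by blast
    then show ?thesis using that(3) sub by auto
  qed
  \<comment> \<open>Negation reverses the order for the non-minimal colours, so
    \<open>card_not_leading_le\<close> serves both directions.\<close>
  define \<kappa> where "\<kappa> l j = (if \<forall>c. (c, l) \<notin> P - Id then int j else - int j)" for l j
  have inj: "inj_on (\<kappa> l) {1..N}" for l by (auto simp: \<kappa>_def inj_on_def)
  define F where "F l j \<alpha> = (\<Prod>k\<in>{1..n}. x l j k ^ \<alpha> k)" for l j \<alpha>
  define lead where "lead l s v \<longleftrightarrow> \<not> int p dvd v s \<and> (\<forall>j\<in>{1..N}. \<kappa> l j < \<kappa> l s \<longrightarrow> v j = 0) \<and>
      (\<forall>\<alpha>\<in>?M. int p dvd (\<Sum>j\<in>{1..N}. v j * F l j \<alpha>))" for l s v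
  define B where "B l = {s\<in>{1..N}. \<nexists>v. lead l s v}" for l
  have "card (B l) \<le> card ?M" for l
    unfolding B_def lead_def
    by (rule card_not_leading_le[OF _ finM inj p1]) simp
  then have "card (\<Union>l\<in>{1..d}. B l) \<le> d * card ?M"
    using order_trans[OF card_UN_le[of "{1..d}" B] sum_mono[of "{1..d}" "\<lambda>l. card (B l)" "\<lambda>_. card ?M"]]
    by simp
  \<comment> \<open>Union bound: the non-leading indices of all colours together cannot fill
    \<open>{1..N}\<close>.\<close>
  then have "\<not> {1..N} \<subseteq> (\<Union>l\<in>{1..d}. B l)"
    using large card_mono[of "\<Union>l\<in>{1..d}. B l" "{1..N}"] by (auto simp: B_def)
  then obtain s where s: "s \<in> {1..N}" "\<forall>l\<in>{1..d}. \<exists>v. lead l s v"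
    unfolding B_def by blast
  then obtain v where v: "\<And>l. l \<in> {1..d} \<Longrightarrow> lead l s (v l)" by metis
  let ?I = "{1..d} \<rightarrow>\<^sub>E {1..N}" and ?V = "\<lambda>i. \<Prod>l\<in>{1..d}. v l (i l)"
  let ?s = "\<lambda>l\<in>{1..d}. s"
  have "int p dvd (\<Sum>i\<in>?I. ?V i * (\<Prod>k\<in>{1..n}. 1 - (\<Sum>l\<in>{1..d}. x l (i l) k) ^ (p - 1)))"
    by (rule dvd_weighted_sum) (use v d in \<open>auto simp: lead_def F_def\<close>)
  moreover have "[(\<Sum>i\<in>?I. ?V i * (\<Prod>k\<in>{1..n}. 1 - (\<Sum>l\<in>{1..d}. x l (i l) k) ^ (p - 1))) =
      (\<Sum>i\<in>?I. ?V i * of_bool (Z i))] (mod int p)"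
    unfolding Z_def by (intro cong_sum cong_mult cong_refl prod_one_minus_power_cong p) simp
  ultimately have dvd: "int p dvd (\<Sum>i\<in>?I. ?V i * of_bool (Z i))"
    using cong_dvd_iff by blast
  have "?V i * of_bool (Z i) = 0" if i: "i \<in> ?I" and ne: "i \<noteq> ?s" for i
  proof (rule ccontr)
    assume nz: "?V i * of_bool (Z i) \<noteq> 0"
    then have Zi: "Z i" by simp
    have nz_l: "v l (i l) \<noteq> 0" if "l \<in> {1..d}" for l
      using nz that by auto
    \<comment> \<open>The support of \<open>v l\<close> starts at \<open>s\<close>: this reads s
      \<le> i l for minimal colours and i l \<le> s for the others.\<close>
    have \<kappa>_ge: "\<kappa> l s \<le> \<kappa> l (i l)" if "l \<in> {1..d}" for l
      using v[OF that] nz_l[OF that] PiE_mem[OF i that] unfolding lead_def by force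
    have "i l = s" if "l \<in> {1..d}" for l
    proof (rule monotone_between_constant[OF P(1) _ P(2), where i = i])
      show "\<exists>b\<in>{1..d}. a \<noteq> b" if "a \<in> {1..d}" for a
        using d by (intro bexI[of _ "if a = 1 then 2 else 1"]) auto
      show "i a \<le> i b" if "(a, b) \<in> P - Id" for a b
        using Z_mono[OF i Zi that] .
      show "s \<le> i a" if "a \<in> {1..d}" "\<forall>c. (c, a) \<notin> P - Id" for a
        using \<kappa>_ge[OF that(1)] that(2) by (simp add: \<kappa>_def)
      show "i a \<le> s" if "a \<in> {1..d}" "(c, a) \<in> P - Id" for a c
        using \<kappa>_ge[OF that(1)] that(2) by (auto simp: \<kappa>_def split: if_splits)
    qed (use that in auto)
    then show False using ne PiE_ext[OF i, of ?s] s by auto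
  qed
  then have "(\<Sum>i\<in>?I. ?V i * of_bool (Z i)) = (\<Sum>i\<in>{?s}. ?V i * of_bool (Z i))"
    using s by (intro sum.mono_neutral_right) (auto intro: finite_PiE)
  also have "\<dots> = (\<Prod>l\<in>{1..d}. v l s)"
  proof -
    have "\<forall>k\<in>{1..n}. int p dvd (\<Sum>l\<in>{1..d}. x l s k)"
      using diag[OF s(1)] Fp_sum_eq_Fp_zero_iff[OF p1, of "{1..d}" "\<lambda>l. x l s"] mem s(1) by auto
    then have "Z ?s" by (simp add: Z_def)
    then show ?thesis by simp
  qed
  \<comment> \<open>The one surviving term is divisible by \<open>p\<close>, although none of its
    factors \<open>v l s\<close> is.\<close>
  finally have "int p dvd (\<Prod>l\<in>{1..d}. v l s)" using dvd by simp
  then obtain l where "l \<in> {1..d}" "int p dvd v l s"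
    using p prime_dvd_prod_iff[of "{1..d}" "int p" "\<lambda>l. v l s"] by auto
  then show False using v by (auto simp: lead_def)
qed

section \<open>Choice of the constants\<close>

theorem theorem6p1:
  fixes p d :: nat
  assumes "prime p" and "d > 2"
  shows "\<exists>(C::real) (\<gamma>::real). C > 0 \<and> 1 \<le> \<gamma> \<and> \<gamma> < real p \<and>
    (\<forall>(n::nat) (N::nat) (x :: nat \<Rightarrow> nat \<Rightarrow> nat \<Rightarrow> int).
      n \<ge> 1 \<longrightarrow> sum_ordered_set p n d N x \<longrightarrow> real N \<le> C * \<gamma> ^ n)"
proof -
  have p1: "p > 1" using assms prime_gt_1_nat by blast
  \<comment> \<open>With q = p - 1 the bound q + 1 is \<open>p\<close> itself.\<close>
  obtain t :: real where t: "0 < t" "t < 1" "(\<Sum>a\<le>p - 1. t ^ (3 * a)) / t ^ (p - 1) < real p"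
    using exists_power_sum_ratio_less[of "p - 1"] p1 le_add_diff_inverse2[of 1 p] by fastforce
  define g where "g = (\<Sum>a\<le>p - 1. t ^ (3 * a)) / t ^ (p - 1)"
  have g0: "0 \<le> g" using t by (auto simp: g_def intro!: divide_nonneg_nonneg sum_nonneg)
  have "real N \<le> real d * max 1 g ^ n" if "sum_ordered_set p n d N x" for n N x
  proof -
    have "real N \<le> real (d * card {\<alpha> \<in> {1..n} \<rightarrow>\<^sub>E {..p - 1}. d * sum \<alpha> {1..n} \<le> n * (p - 1)})"
      using sum_ordered_set_card_le[OF assms that] by (simp only: of_nat_le_iff)
    also have "\<dots> \<le> real d * g ^ n"
      using card_low_degree_le[OF t(1,2), of d "{1..n}" "p - 1"] assms(2)
      by (simp add: g_def mult_left_mono)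
    also have "\<dots> \<le> real d * max 1 g ^ n"
      using g0 by (intro mult_left_mono power_mono) auto
    finally show ?thesis .
  qed
  \<comment> \<open>The maximum with 1 secures 1 \<le> \<gamma>; it stays below \<open>p\<close>
    because both 1 and \<open>g\<close> do.\<close>
  then show ?thesis
    using assms p1 t by (intro exI[of _ "real d"] exI[of _ "max 1 g"]) (auto simp: g_def)
qed

end
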